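(* Let $\xi\ge0$ a.s. Then for any $p\ge1$ and $t\in\mathbb{R}$, the following assertions are equivalent: (1) $\mathbb{E}Z(t)^p<\infty$; (2) $s_q(t):=\int\mathbb{E}\big(X(t-y)^q\big)\,\mathbb{U}(dy)<\infty$ for all $q\in[1,p]$.
   Context: Let $\xi$ be a real-valued random variable with $\mathbb{P}\{\xi=0\}<1$ and let $(X(t))_{t\in\mathbb{R}}$ be a nonnegative (finite-valued) stochastic process with nondecreasing paths such that $\lim_{t\to-\infty}X(t)=0$ a.s. Any dependence between $(X(t))_{t\in\mathbb{R}}$ and $\xi$ is allowed. Let $((X_n(t))_{t\in\mathbb{R}},\xi_n)_{n\ge1}$ be a sequence of independent copies of $((X(t))_{t\in\mathbb{R}},\xi)$. Put $S_0:=0$, $S_n:=\xi_1+\cdots+\xi_n$ for $n\in\mathbb{N}$, and define the renewal shot-noise process $Z(t):=\sum_{n\ge1}X_n(t-S_{n-1})$, $t\in\mathbb{R}$. Let $\mathbb{U}:=\sum_{n\ge0}\mathbb{P}\{S_n\in\cdot\}$ be the renewal measure of $(S_n)_{n\ge0}$. $\mathbb{E}Z(t)^p$ means $\mathbb{E}(Z(t)^p)$. *)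

theory Defs
  imports "HOL-Probability.Probability"
begin

text \<open>
  Path space of a finite-valued nonnegative process with nondecreasing paths. As the set of these
  paths is not measurable in the product space, it carries the trace of the product
  \<open>\<sigma>\<close>-algebra; hence laws and independence are those given by the finite-dimensional
  distributions. No right-continuity is assumed.
\<close>

definition monotone_paths :: "(real \<Rightarrow> real) measure" where
  "monotone_paths = restrict_space (\<Pi>\<^sub>M t\<in>UNIV. borel) {f. mono f \<and> (\<forall>t. 0 \<le> f t)}"

definition independent_copies ::
  "'b measure \<Rightarrow> 'a measure \<Rightarrow> 'c measure \<Rightarrow> ('b \<Rightarrow> 'c) \<Rightarrow> (nat \<Rightarrow> 'a \<Rightarrow> 'c) \<Rightarrow> bool" where
  "independent_copies N M L Y Ys \<longleftrightarrow>
     prob_space.indep_vars M (\<lambda>_. L) Ys {1..} \<and> (\<forall>n\<ge>1. distr M L (Ys n) = distr N L Y)"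

definition random_walk :: "(nat \<Rightarrow> 'a \<Rightarrow> real) \<Rightarrow> nat \<Rightarrow> 'a \<Rightarrow> real" where
  "random_walk \<xi>s n \<omega> = (\<Sum>k=1..n. \<xi>s k \<omega>)"

text \<open>The summation index is shifted by one against \<open>Z(t) = \<Sum>n\<ge>1. X\<^sub>n(t - S\<^bsub>n-1\<^esub>)\<close>.\<close>

definition shot_noise ::
  "(nat \<Rightarrow> 'a \<Rightarrow> real \<Rightarrow> real) \<Rightarrow> (nat \<Rightarrow> 'a \<Rightarrow> real) \<Rightarrow> real \<Rightarrow> 'a \<Rightarrow> ennreal" where
  "shot_noise Xs \<xi>s t \<omega> = (\<Sum>n. ennreal (Xs (Suc n) \<omega> (t - random_walk \<xi>s n \<omega>)))"

definition renewal_measure :: "'a measure \<Rightarrow> (nat \<Rightarrow> 'a \<Rightarrow> real) \<Rightarrow> real measure" where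
  "renewal_measure M \<xi>s =
     measure_of UNIV (sets borel) (\<lambda>B. \<Sum>n. emeasure (distr M borel (random_walk \<xi>s n)) B)"

lemma sets_renewal_measure [simp, measurable_cong]: "sets (renewal_measure M \<xi>s) = sets borel"
  unfolding renewal_measure_def
  by (metis sets.sets_measure_of_eq space_borel)

lemma emeasure_renewal_measure:
  assumes "B \<in> sets borel"
  shows "emeasure (renewal_measure M \<xi>s) B =
    (\<Sum>n. emeasure (distr M borel (random_walk \<xi>s n)) B)"
  unfolding renewal_measure_def
proof (rule emeasure_measure_of_sigma)
  show "sigma_algebra UNIV (sets (borel :: real measure))"
    by (metis sets.sigma_algebra_axioms space_borel)
  show "positive (sets borel) (\<lambda>B. \<Sum>n. emeasure (distr M borel (random_walk \<xi>s n)) B)"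
    by (simp add: positive_def)
  show "countably_additive (sets borel)
      (\<lambda>B. \<Sum>n. emeasure (distr M borel (random_walk \<xi>s n)) B)"
  proof (rule countably_additiveI)
    fix A :: "nat \<Rightarrow> real set"
    assume A: "range A \<subseteq> sets borel" "disjoint_family A"
    have "(\<Sum>i. \<Sum>n. emeasure (distr M borel (random_walk \<xi>s n)) (A i)) =
        (\<Sum>n. \<Sum>i. emeasure (distr M borel (random_walk \<xi>s n)) (A i))"
      using nn_integral_suminf [where M = "count_space UNIV"
          and f = "\<lambda>i n. emeasure (distr M borel (random_walk \<xi>s n)) (A i)"]
      by (simp add: nn_integral_count_space_nat)
    also have "\<dots> = (\<Sum>n. emeasure (distr M borel (random_walk \<xi>s n)) (\<Union>i. A i))"
      using A by (intro suminf_cong suminf_emeasure) auto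
    finally show "(\<Sum>i. \<Sum>n. emeasure (distr M borel (random_walk \<xi>s n)) (A i)) =
        (\<Sum>n. emeasure (distr M borel (random_walk \<xi>s n)) (\<Union>i. A i))" .
  qed
qed (use assms in auto)

text \<open>Real powers with positive exponent on \<open>[0, \<infinity>]\<close>, since the shot noise may be infinite.\<close>

definition ennreal_powr :: "ennreal \<Rightarrow> real \<Rightarrow> ennreal" where
  "ennreal_powr x p = (if x = \<top> then \<top> else ennreal (enn2real x powr p))"

definition power_moment_integral ::
  "'b measure \<Rightarrow> ('b \<Rightarrow> real \<Rightarrow> real) \<Rightarrow> real measure \<Rightarrow> real \<Rightarrow> real \<Rightarrow> ennreal" where
  "power_moment_integral N X U q t =
     (\<integral>\<^sup>+ y. (\<integral>\<^sup>+ \<omega>. ennreal (X \<omega> (t - y) powr q) \<partial>N) \<partial>U)"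

end

theory Submission
  imports Defs
begin

text \<open>
  Write \<open>a\<^sub>n\<close> for the \<open>n\<close>-th summand of \<open>Z(t)\<close> and \<open>R\<^sub>n\<close> for the sum of the summands from the
  \<open>n\<close>-th on. Then \<open>s\<^sub>q(t) = \<Sum> E a\<^sub>n\<^sup>q\<close>, and (1) implies (2) because
  \<open>\<Sum> a\<^sub>n\<^sup>q \<le> Z\<^sup>q \<le> 1 + Z\<^sup>p\<close>. Conversely, telescoping \<open>R\<^sub>n\<^sup>p\<close> bounds \<open>Z\<^sup>p\<close> by a multiple of
  \<open>\<Sum> (a\<^sub>n\<^sup>p + a\<^sub>n R\<^bsub>n+1\<^esub>\<^bsup>p-1\<^esup>)\<close>. As the walk is nondecreasing, \<open>R\<^bsub>n+1\<^esub>\<close> is at most a copy of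
  \<open>Z(t)\<close> that is independent of \<open>a\<^sub>n\<close>, whence
  \<open>E Z\<^sup>p \<le> c (s\<^sub>p(t) + s\<^sub>1(t) E Z\<^bsup>p-1\<^esup>)\<close>, and the claim follows by induction on \<open>\<lceil>p\<rceil>\<close>.

  Without right-continuity, evaluation of a path at a random time is not jointly measurable. It
  is replaced by the supremum over the preceding or equal times in a countable set \<open>C\<close> containing the
  rationals and the fixed discontinuities; almost surely this changes nothing at a time
  independent of the path.
\<close>

section \<open>Real powers on the extended half-line\<close>

lemma ennreal_powr_ennreal: "0 \<le> x \<Longrightarrow> ennreal_powr (ennreal x) p = ennreal (x powr p)"
  by (simp add: ennreal_powr_def)

lemma ennreal_powr_top [simp]: "ennreal_powr \<top> p = \<top>"
  by (simp add: ennreal_powr_def)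

lemma ennreal_powr_zero [simp]: "ennreal_powr 0 p = 0"
  by (simp add: ennreal_powr_def)

lemma ennreal_powr_one [simp]: "ennreal_powr x 1 = x"
  by (cases x) (simp_all add: ennreal_powr_ennreal)

lemma ennreal_powr_mono: "0 \<le> p \<Longrightarrow> x \<le> y \<Longrightarrow> ennreal_powr x p \<le> ennreal_powr y p"
  by (cases x; cases y) (auto simp: ennreal_powr_ennreal top_unique intro: powr_mono2 ennreal_leI)

lemma measurable_ennreal_powr [measurable (raw)]:
  "f \<in> borel_measurable M \<Longrightarrow> (\<lambda>x. ennreal_powr (f x) p) \<in> borel_measurable M"
  unfolding ennreal_powr_def by (intro measurable_If) auto

text \<open>At the endpoints the conventions agree: both sides are 0 at 0 and \<open>\<top>\<close>
  at \<open>\<top>\<close>, also when \<open>s = 0\<close>.\<close>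

lemma ennreal_powr_split: "ennreal_powr x (1 + s) = x * ennreal_powr x s"
proof (cases x)
  case (real r)
  then show ?thesis
    by (cases "r = 0") (auto simp: ennreal_powr_ennreal powr_add simp flip: ennreal_mult)
qed simp

text \<open>For \<open>x \<le> 1\<close> the constant dominates, for larger \<open>x\<close> the
  larger exponent does.\<close>

lemma ennreal_powr_le_one_plus:
  assumes "0 \<le> q" "q \<le> p"
  shows "ennreal_powr x q \<le> 1 + ennreal_powr x p"
proof (cases x)
  case (real r)
  have "r powr q \<le> 1 + r powr p"
  proof (cases "r \<le> 1")
    case True
    then have "r powr q \<le> 1"
      using real assms by (auto intro: powr_le1)
    then show ?thesis
      using powr_ge_zero[of r p] by linarith
  next
    case False
    then show ?thesis
      using powr_mono[of q p r] assms by linarith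
  qed
  then have "ennreal (r powr q) \<le> ennreal (1 + r powr p)"
    by (rule ennreal_leI)
  then show ?thesis
    using real by (simp add: ennreal_powr_ennreal ennreal_plus)
qed simp

text \<open>The sum is at most twice the maximum, and the power of the maximum is one of the two
  powers.\<close>

lemma ennreal_powr_add_le:
  assumes "0 \<le> s"
  shows "ennreal_powr (x + y) s \<le> ennreal (2 powr s) * (ennreal_powr x s + ennreal_powr y s)"
proof (cases "x = \<top> \<or> y = \<top>")
  case True
  then show ?thesis
    by (auto simp: ennreal_mult_top)
next
  case False
  then obtain a b where ab: "x = ennreal a" "y = ennreal b" "0 \<le> a" "0 \<le> b"
    by (metis ennreal_cases)
  have "(a + b) powr s \<le> (2 * max a b) powr s"
    using ab assms by (intro powr_mono2) auto
  also have "\<dots> = 2 powr s * (max a b) powr s"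
    using ab by (simp add: powr_mult)
  also have "\<dots> \<le> 2 powr s * (a powr s + b powr s)"
    by (intro mult_left_mono) (auto simp: max_def)
  finally have "ennreal ((a + b) powr s) \<le> ennreal (2 powr s * (a powr s + b powr s))"
    by (rule ennreal_leI)
  then show ?thesis
    using ab by (simp add: ennreal_powr_ennreal ennreal_mult flip: ennreal_plus)
qed

section \<open>Power inequalities for series\<close>

text \<open>Write each power as \<open>a n\<close> times its power of order \<open>q - 1\<close> and
  bound the second factor by that power of the whole sum.\<close>

lemma suminf_ennreal_powr_le:
  fixes a :: "nat \<Rightarrow> ennreal"
  assumes "1 \<le> q"
  shows "(\<Sum>n. ennreal_powr (a n) q) \<le> ennreal_powr (\<Sum>n. a n) q"
proof -
  have split: "ennreal_powr x q = x * ennreal_powr x (q - 1)" for x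
    using ennreal_powr_split[of x "q - 1"] by simp
  have "a n \<le> (\<Sum>n. a n)" for n
    using sum_le_suminf[of a "{n}"] by simp
  then have "(\<Sum>n. ennreal_powr (a n) q) \<le> (\<Sum>n. a n * ennreal_powr (\<Sum>n. a n) (q - 1))"
    using assms unfolding split by (intro suminf_le mult_left_mono ennreal_powr_mono) auto
  then show ?thesis
    by (simp add: split)
qed

text \<open>Mean value theorem for the \<open>p\<close>-th power on \<open>[b, a + b]\<close>; the
  derivative is largest at the right end since \<open>p - 1 \<ge> 0\<close>.\<close>

lemma powr_diff_le:
  fixes a b :: real
  assumes "0 \<le> a" "0 \<le> b" "1 \<le> p"
  shows "(a + b) powr p \<le> p * (a * (a + b) powr (p - 1)) + b powr p"
\<comment> \<open>Set apart because the mean value theorem needs a nondegenerate interval and, for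
  the derivative, positive points.\<close>
proof (cases "a = 0 \<or> b = 0")
  case True
  have "a powr p \<le> p * (a * a powr (p - 1))"
    using assms by (cases "a = 0") (auto simp: powr_diff)
  with True show ?thesis
    by auto
next
  case False
  then have pos: "0 < a" "0 < b"
    using assms by auto
  have "\<exists>z>b. z < a + b \<and> (a + b) powr p - b powr p = (a + b - b) * (p * z powr (p - 1))"
    using pos by (intro MVT2) (auto intro!: derivative_eq_intros)
  then obtain z where z: "b < z" "z < a + b" "(a + b) powr p - b powr p = a * (p * z powr (p - 1))"
    by auto
  have "a * (p * z powr (p - 1)) \<le> a * (p * (a + b) powr (p - 1))"
    using z pos assms by (intro mult_left_mono powr_mono2) auto
  with z show ?thesis
    by (simp add: algebra_simps)
qed

lemma ennreal_powr_diff_le: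
  assumes "1 \<le> p"
  shows "ennreal_powr (x + y) p \<le>
    ennreal p * (x * ennreal_powr (x + y) (p - 1)) + ennreal_powr y p"
proof (cases "x = \<top> \<or> y = \<top>")
  case True
  then show ?thesis
    using assms by (auto simp: ennreal_mult_top ennreal_mult_eq_top_iff)
next
  case False
  then obtain a b where ab: "x = ennreal a" "y = ennreal b" "0 \<le> a" "0 \<le> b"
    by (metis ennreal_cases)
  have sum: "x + y = ennreal (a + b)"
    using ab by simp
  have "ennreal ((a + b) powr p) \<le> ennreal (p * (a * (a + b) powr (p - 1)) + b powr p)"
    using ab assms by (intro ennreal_leI powr_diff_le)
  also have "\<dots> = ennreal p * (x * ennreal ((a + b) powr (p - 1))) + ennreal (b powr p)"
    using ab assms by (simp add: ennreal_mult)
  finally show ?thesis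
    unfolding sum using ab by (simp add: ennreal_powr_ennreal del: ennreal_plus)
qed

lemma suminf_split_head_ennreal:
  fixes f :: "nat \<Rightarrow> ennreal"
  shows "(\<Sum>n. f n) = f 0 + (\<Sum>n. f (Suc n))"
  using suminf_offset[of f 1] by simp

text \<open>Only the part of a tail beyond its first summand is kept as a factor, since that part will
  be bounded by a variable independent of the first summand.\<close>

lemma ennreal_powr_suminf_le:
  fixes a :: "nat \<Rightarrow> ennreal"
  assumes "1 \<le> p" and fin: "(\<Sum>n. a n) < \<top>"
  shows "ennreal_powr (\<Sum>n. a n) p \<le> ennreal (p * 2 powr (p - 1)) *
    (\<Sum>n. ennreal_powr (a n) p + a n * ennreal_powr (\<Sum>k. a (k + Suc n)) (p - 1))"
proof -
  define R where "R n = (\<Sum>k. a (k + n))" for n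
  define c where "c n = ennreal_powr (a n) p + a n * ennreal_powr (R (Suc n)) (p - 1)" for n
  let ?C = "ennreal (p * 2 powr (p - 1))"
  have R_Suc: "R n = a n + R (Suc n)" for n
    unfolding R_def using suminf_split_head_ennreal[of "\<lambda>k. a (k + n)"] by simp
  have split: "ennreal_powr x p = x * ennreal_powr x (p - 1)" for x
    using ennreal_powr_split[of x "p - 1"] by simp
  \<comment> \<open>One telescoping step. The factor \<open>R n\<close> from the mean value bound is
    split into \<open>a n\<close> and \<open>R (Suc n)\<close>, which costs the constant
    \<open>2 powr (p - 1)\<close>.\<close>
  have step: "ennreal_powr (R n) p \<le> ?C * c n + ennreal_powr (R (Suc n)) p" for n
  proof -
    have "ennreal_powr (R n) p \<le>
        ennreal p * (a n * ennreal_powr (R n) (p - 1)) + ennreal_powr (R (Suc n)) p"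
      using ennreal_powr_diff_le[OF \<open>1 \<le> p\<close>, of "a n" "R (Suc n)"] by (simp add: R_Suc[of n])
    also have "\<dots> \<le> ennreal p * (a n * (ennreal (2 powr (p - 1)) *
          (ennreal_powr (a n) (p - 1) + ennreal_powr (R (Suc n)) (p - 1)))) +
        ennreal_powr (R (Suc n)) p"
      using ennreal_powr_add_le[of "p - 1" "a n" "R (Suc n)"] \<open>1 \<le> p\<close>
      by (intro add_right_mono mult_left_mono) (auto simp: R_Suc[of n])
    also have "\<dots> = ?C * c n + ennreal_powr (R (Suc n)) p"
      using \<open>1 \<le> p\<close> unfolding c_def split[of "a n"] by (simp add: ennreal_mult algebra_simps)
    finally show ?thesis .
  qed
  have partial: "ennreal_powr (R 0) p \<le> ?C * (\<Sum>k<n. c k) + ennreal_powr (R n) p" for n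
  proof (induction n)
    case (Suc n)
    also have "?C * (\<Sum>k<n. c k) + ennreal_powr (R n) p \<le>
        ?C * (\<Sum>k<n. c k) + (?C * c n + ennreal_powr (R (Suc n)) p)"
      by (intro add_left_mono step)
    finally show ?case
      by (simp add: algebra_simps)
  qed simp
  \<comment> \<open>Passing to real summands shows that the tails vanish: this is where finiteness
    of the sum enters.\<close>
  have a_fin: "a n < \<top>" for n
    using fin by (rule ennreal_suminf_lessD)
  define b where "b n = enn2real (a n)" for n
  have b: "a n = ennreal (b n)" "0 \<le> b n" for n
    using a_fin[of n] unfolding b_def by auto
  have summable: "summable b"
    using fin b by (intro summable_suminf_not_top) auto
  have R: "R n = ennreal (\<Sum>k. b (k + n))" for n
    unfolding R_def b using b summable by (intro suminf_ennreal2) auto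
  have "(\<lambda>n. \<Sum>k. b (k + n)) \<longlonglongrightarrow> 0"
    using tendsto_diff[OF tendsto_const[of "suminf b"] summable_LIMSEQ[OF summable]]
    by (simp add: suminf_minus_initial_segment[OF summable])
  then have "(\<lambda>n. (\<Sum>k. b (k + n)) powr p) \<longlonglongrightarrow> 0"
    using \<open>1 \<le> p\<close> b summable by (intro tendsto_zero_powrI[where b = p]) (auto simp: suminf_nonneg)
  moreover have "ennreal_powr (R n) p = ennreal ((\<Sum>k. b (k + n)) powr p)" for n
    unfolding R using b summable by (intro ennreal_powr_ennreal suminf_nonneg) auto
  ultimately have lim: "(\<lambda>n. ennreal_powr (R n) p) \<longlonglongrightarrow> 0"
    by (simp add: tendsto_ennrealI flip: ennreal_0)
  \<comment> \<open>The left side is free of \<open>n\<close>, so the remainder can be sent to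
    0.\<close>
  have "ennreal_powr (R 0) p \<le> ?C * (\<Sum>k. c k) + ennreal_powr (R n) p" for n
    using sum_le_suminf[of c "{..<n}"]
    by (intro order_trans[OF partial[of n]] add_right_mono mult_left_mono) auto
  then have "ennreal_powr (R 0) p \<le> ?C * (\<Sum>k. c k) + 0"
    by (intro LIMSEQ_le_const[OF tendsto_add[OF tendsto_const lim]]) auto
  then show ?thesis
    by (simp add: R_def c_def)
qed

section \<open>Measurable evaluation of monotone paths\<close>

text \<open>Points of \<open>C\<close> beyond \<open>x\<close> contribute the neutral value 0. The
  index set thus does not depend on \<open>x\<close>, and a countable supremum of jointly measurable
  functions results.\<close>

definition lower_eval :: "real set \<Rightarrow> (real \<Rightarrow> real) \<Rightarrow> real \<Rightarrow> ennreal" where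
  "lower_eval C f x = (SUP c\<in>C. if c \<le> x then ennreal (f c) else 0)"

text \<open>Counterpart from above, with neutral value \<open>\<top>\<close>. A monotone path lies
  between the two, so wherever they agree both equal its value.\<close>

definition upper_eval :: "real set \<Rightarrow> (real \<Rightarrow> real) \<Rightarrow> real \<Rightarrow> ennreal" where
  "upper_eval C f x = (INF c\<in>C. if x \<le> c then ennreal (f c) else \<top>)"

lemma space_monotone_paths: "f \<in> space monotone_paths \<longleftrightarrow> mono f \<and> (\<forall>x. 0 \<le> f x)"
  by (simp add: monotone_paths_def space_restrict_space space_PiM)

lemma measurable_path_at [measurable]: "(\<lambda>f. f x) \<in> borel_measurable monotone_paths"
  unfolding monotone_paths_def by (intro measurable_restrict_space1) measurable

lemma measurable_lower_eval [measurable (raw)]: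
  assumes C: "countable C" and f [measurable]: "f \<in> measurable M monotone_paths"
    and g [measurable]: "g \<in> borel_measurable M"
  shows "(\<lambda>w. lower_eval C (f w) (g w)) \<in> borel_measurable M"
  unfolding lower_eval_def
proof (rule borel_measurable_SUP[OF C])
  fix c
  have [measurable]: "(\<lambda>w. f w c) \<in> borel_measurable M"
    using measurable_compose[OF f measurable_path_at] .
  show "(\<lambda>w. if c \<le> g w then ennreal (f w c) else 0) \<in> borel_measurable M"
    by measurable
qed

lemma measurable_upper_eval [measurable (raw)]:
  assumes C: "countable C" and f [measurable]: "f \<in> measurable M monotone_paths"
    and g [measurable]: "g \<in> borel_measurable M"
  shows "(\<lambda>w. upper_eval C (f w) (g w)) \<in> borel_measurable M"
  unfolding upper_eval_def
proof (rule borel_measurable_INF[OF C])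
  fix c
  have [measurable]: "(\<lambda>w. f w c) \<in> borel_measurable M"
    using measurable_compose[OF f measurable_path_at] .
  show "(\<lambda>w. if g w \<le> c then ennreal (f w c) else \<top>) \<in> borel_measurable M"
    by measurable
qed

lemma lower_eval_mono: "x \<le> y \<Longrightarrow> lower_eval C f x \<le> lower_eval C f y"
  unfolding lower_eval_def by (intro SUP_mono') auto

lemma lower_eval_le: "mono f \<Longrightarrow> lower_eval C f x \<le> ennreal (f x)"
  unfolding lower_eval_def by (intro SUP_least) (auto simp: mono_def intro: ennreal_leI)

lemma le_upper_eval: "mono f \<Longrightarrow> ennreal (f x) \<le> upper_eval C f x"
  unfolding upper_eval_def by (intro INF_greatest) (auto simp: mono_def intro: ennreal_leI)

lemma lower_eval_eq_upper_eval_mem: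
  assumes "mono f" "x \<in> C"
  shows "lower_eval C f x = upper_eval C f x"
proof (rule antisym)
  show "lower_eval C f x \<le> upper_eval C f x"
    using lower_eval_le le_upper_eval assms order_trans by blast
  have "upper_eval C f x \<le> ennreal (f x)"
    unfolding upper_eval_def by (rule INF_lower2[OF \<open>x \<in> C\<close>]) simp
  also have "\<dots> \<le> lower_eval C f x"
    unfolding lower_eval_def by (rule SUP_upper2[OF \<open>x \<in> C\<close>]) simp
  finally show "upper_eval C f x \<le> lower_eval C f x" .
qed

text \<open>For each level \<open>a\<close> the probability that \<open>X\<close> exceeds
  \<open>a\<close> is monotone in time, hence has countably many discontinuities. At a continuity
  point the path almost surely does not jump across the level.\<close>

lemma (in prob_space) AE_lower_eval_eq_upper_eval:
  assumes X [measurable]: "X \<in> measurable M monotone_paths"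
  obtains C where "countable C"
    and "\<And>x. AE \<omega> in M. lower_eval C (X \<omega>) x = upper_eval C (X \<omega>) x"
proof
  define F where "F a x = prob {\<omega>\<in>space M. ennreal (X \<omega> x) > a}" for a x
  \<comment> \<open>Rational levels suffice: every gap between the two evaluations contains
    one.\<close>
  define D where "D = (\<Union>q\<in>\<rat>. {x. \<not> isCont (F (ennreal q)) x})"
  let ?C = "\<rat> \<union> D"
  have meas [measurable]: "(\<lambda>\<omega>. X \<omega> x) \<in> borel_measurable M" for x
    using measurable_compose[OF X measurable_path_at] .
  have mono: "mono (X \<omega>)" if "\<omega> \<in> space M" for \<omega>
    using measurable_space[OF X that] by (simp add: space_monotone_paths)
  have F_mono: "mono (F a)" for a
    unfolding F_def
    by (intro monoI finite_measure_mono Collect_mono)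
      (auto intro: less_le_trans[OF _ ennreal_leI[OF monoD[OF mono]]])
  have "countable D"
    unfolding D_def by (intro countable_UN mono_ctble_discont F_mono) (rule countable_rat)
  then show C: "countable ?C"
    using countable_rat by auto
  fix x
  show "AE \<omega> in M. lower_eval ?C (X \<omega>) x = upper_eval ?C (X \<omega>) x"
  proof (cases "x \<in> ?C")
    case True
    then show ?thesis
      using lower_eval_eq_upper_eval_mem mono by (intro AE_I2) blast
  next
    case False
    note [measurable] = measurable_lower_eval[OF C X] measurable_upper_eval[OF C X]
    have null: "AE \<omega> in M. \<not> (lower_eval ?C (X \<omega>) x < ennreal q \<and> ennreal q < upper_eval ?C (X \<omega>) x)"
      if q: "q \<in> \<rat>" for q
    proof -
      let ?A = "{\<omega>\<in>space M. lower_eval ?C (X \<omega>) x < ennreal q \<and> ennreal q < upper_eval ?C (X \<omega>) x}"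
      have [measurable]: "?A \<in> events"
        by measurable
      have cont: "isCont (F (ennreal q)) x"
        using False q unfolding D_def by auto
      have "prob ?A \<le> 0 + e" if "e > 0" for e
      proof -
        from cont obtain d where d: "d > 0"
          "\<And>y. \<bar>y - x\<bar> < d \<Longrightarrow> \<bar>F (ennreal q) y - F (ennreal q) x\<bar> < e / 2"
          using \<open>e > 0\<close> unfolding continuous_at_eps_delta dist_real_def
          by (auto dest: spec[of _ "e / 2"])
        \<comment> \<open>Rational neighbours belong to \<open>?C\<close>, so the path at
          \<open>l\<close> and \<open>u\<close> encloses both evaluations at
          \<open>x\<close>.\<close>
        obtain l where l: "l \<in> \<rat>" "x - d < l" "l < x"
          using Rats_dense_in_real[of "x - d" x] d by auto
        obtain u where u: "u \<in> \<rat>" "x < u" "u < x + d"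
          using Rats_dense_in_real[of x "x + d"] d by auto
        have lo: "ennreal (X \<omega> l) \<le> lower_eval ?C (X \<omega>) x" for \<omega>
          unfolding lower_eval_def using l by (intro SUP_upper2[of l]) auto
        have up: "upper_eval ?C (X \<omega>) x \<le> ennreal (X \<omega> u)" for \<omega>
          unfolding upper_eval_def using u by (intro INF_lower2[of u]) auto
        \<comment> \<open>A gap around \<open>q\<close> at \<open>x\<close> forces the path to pass
          the level between \<open>l\<close> and \<open>u\<close>.\<close>
        have "?A \<subseteq> {\<omega>\<in>space M. ennreal (X \<omega> u) > ennreal q} -
            {\<omega>\<in>space M. ennreal (X \<omega> l) > ennreal q}"
          using less_le_trans[OF _ up] less_asym[OF le_less_trans[OF lo]]
          by auto
        then have "prob ?A \<le> prob ({\<omega>\<in>space M. ennreal (X \<omega> u) > ennreal q} -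
            {\<omega>\<in>space M. ennreal (X \<omega> l) > ennreal q})"
          by (intro finite_measure_mono) auto
        also have "\<dots> = F (ennreal q) u - F (ennreal q) l"
          unfolding F_def using l u
          by (intro finite_measure_Diff)
            (auto intro: less_le_trans[OF _ ennreal_leI[OF monoD[OF mono, of _ l u]]])
        also have "\<dots> \<le> e"
        proof -
          have "\<bar>F (ennreal q) l - F (ennreal q) x\<bar> < e / 2" "\<bar>F (ennreal q) u - F (ennreal q) x\<bar> < e / 2"
            using d(2) l u by auto
          then show ?thesis
            by linarith
        qed
        finally show ?thesis
          by simp
      qed
      then have "prob ?A \<le> 0"
        by (rule field_le_epsilon)
      then have "?A \<in> null_sets M"
        by (simp add: null_sets_def emeasure_eq_measure measure_le_0_iff)
      then show ?thesis
        by (rule AE_I') auto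
    qed
    have "AE \<omega> in M. \<forall>q\<in>\<rat>.
        \<not> (lower_eval ?C (X \<omega>) x < ennreal q \<and> ennreal q < upper_eval ?C (X \<omega>) x)"
      using null by (intro AE_ball_countable[THEN iffD2]) (auto simp: countable_rat)
    then show ?thesis
      using AE_space[of M]
    proof eventually_elim
      case (elim \<omega>)
      show ?case
      proof (rule ccontr)
        assume "lower_eval ?C (X \<omega>) x \<noteq> upper_eval ?C (X \<omega>) x"
        then have "lower_eval ?C (X \<omega>) x < upper_eval ?C (X \<omega>) x"
          using order_trans[OF lower_eval_le[of "X \<omega>"] le_upper_eval[of "X \<omega>"], of ?C x ?C] mono elim
          by (auto simp: less_le)
        with ennreal_rat_dense obtain r :: rat where
          "lower_eval ?C (X \<omega>) x < real_of_rat r" "real_of_rat r < upper_eval ?C (X \<omega>) x"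
          by blast
        with elim show False
          by auto
      qed
    qed
  qed
qed

section \<open>Walk and noise on the space of sequences\<close>

text \<open>Coordinates count from 0: coordinate \<open>k\<close> stands for the pair with index
  \<open>k + 1\<close>, so this is \<open>S\<^sub>n\<close>.\<close>

definition walk :: "(nat \<Rightarrow> 'c \<times> real) \<Rightarrow> nat \<Rightarrow> real" where
  "walk y n = (\<Sum>k<n. snd (y k))"

text \<open>The path comes from coordinate \<open>n\<close>, the walk only from coordinates below
  \<open>n\<close>; under a product law they are independent.\<close>

definition noise :: "real set \<Rightarrow> real \<Rightarrow> (nat \<Rightarrow> (real \<Rightarrow> real) \<times> real) \<Rightarrow> nat \<Rightarrow> ennreal" where
  "noise C t y n = lower_eval C (fst (y n)) (t - walk y n)"

definition total_noise :: "real set \<Rightarrow> real \<Rightarrow> (nat \<Rightarrow> (real \<Rightarrow> real) \<times> real) \<Rightarrow> ennreal" where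
  "total_noise C t y = (\<Sum>n. noise C t y n)"

lemma walk_comb_seq_le: "k \<le> n \<Longrightarrow> walk (comb_seq n y z) k = walk y k"
  unfolding walk_def by (intro sum.cong) (auto simp: comb_seq_def)

lemma walk_comb_seq_add: "walk (comb_seq n y z) (k + n) = walk y n + walk z k"
proof (induction k)
  case 0
  then show ?case
    by (simp add: walk_comb_seq_le) (simp add: walk_def)
next
  case (Suc k)
  then show ?case
    by (simp add: walk_def comb_seq_add)
qed

lemma noise_comb_seq_less: "k < n \<Longrightarrow> noise C t (comb_seq n y z) k = noise C t y k"
  by (simp add: noise_def walk_comb_seq_le comb_seq_less)

text \<open>Renewal structure: after \<open>n\<close> steps the noise starts afresh from
  \<open>z\<close>, delayed by the position reached.\<close>

lemma noise_comb_seq_add: "noise C t (comb_seq n y z) (k + n) = noise C (t - walk y n) z k"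
  by (simp add: noise_def walk_comb_seq_add comb_seq_add algebra_simps)

lemma noise_mono: "t \<le> u \<Longrightarrow> noise C t y n \<le> noise C u y n"
  unfolding noise_def by (intro lower_eval_mono) simp

section \<open>Splitting an i.i.d. sequence at a fixed index\<close>

context sequence_space
begin

text \<open>Gluing the first \<open>n\<close> coordinates of one i.i.d. sequence to an independent
  copy again has law \<open>S\<close>; Tonelli then separates the two.\<close>

lemma nn_integral_comb_seq:
  assumes [measurable]: "f \<in> borel_measurable S"
  shows "(\<integral>\<^sup>+ y. f y \<partial>S) = (\<integral>\<^sup>+ y. \<integral>\<^sup>+ z. f (comb_seq n y z) \<partial>S \<partial>S)"
proof -
  have "(\<integral>\<^sup>+ y. f y \<partial>S) = (\<integral>\<^sup>+ y. f y \<partial>distr (S \<Otimes>\<^sub>M S) S (\<lambda>(y, z). comb_seq n y z))"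
    by (simp add: PiM_comb_seq)
  also have "\<dots> = (\<integral>\<^sup>+ x. f (comb_seq n (fst x) (snd x)) \<partial>(S \<Otimes>\<^sub>M S))"
    by (subst nn_integral_distr[OF measurable_comb_seq]) (auto simp: split_beta')
  also have "\<dots> = (\<integral>\<^sup>+ y. \<integral>\<^sup>+ z. f (comb_seq n y z) \<partial>S \<partial>S)"
    by (subst P.nn_integral_fst[symmetric]) auto
  finally show ?thesis .
qed

lemma nn_integral_component:
  assumes "f \<in> borel_measurable M"
  shows "(\<integral>\<^sup>+ y. f (y n) \<partial>S) = (\<integral>\<^sup>+ x. f x \<partial>M)"
  using nn_integral_distr[of "\<lambda>y. y n" S M f] PiM_component[of n] assms by simp

end

section \<open>Noise and its moments under the product law\<close>

text \<open>\<open>Q\<close> is the law of a single pair of path and step. In \<open>AE_eval\<close>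
  the exceptional set may depend on the time \<open>x\<close>.\<close>

locale renewal_law = sequence_space Q for Q :: "((real \<Rightarrow> real) \<times> real) measure" +
  fixes C :: "real set"
  assumes sets_Q [measurable_cong]: "sets Q = sets (monotone_paths \<Otimes>\<^sub>M borel)"
    and countable_C: "countable C"
    and AE_eval: "\<And>x. AE y in Q. lower_eval C (fst y) x = upper_eval C (fst y) x"
    and AE_nonneg: "AE y in Q. 0 \<le> snd y"
begin

lemma measurable_fst_Q [measurable]: "fst \<in> measurable Q monotone_paths"
  by measurable

lemma measurable_walk [measurable]: "(\<lambda>y. walk y n) \<in> borel_measurable S"
  unfolding walk_def by measurable

lemma measurable_lower_eval_Q [measurable (raw)]:
  assumes [measurable]: "f \<in> measurable K Q" "g \<in> borel_measurable K"
  shows "(\<lambda>w. lower_eval C (fst (f w)) (g w)) \<in> borel_measurable K"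
  by (rule measurable_lower_eval[OF countable_C]) measurable

lemma measurable_noise [measurable]: "(\<lambda>y. noise C t y n) \<in> borel_measurable S"
  unfolding noise_def by measurable

lemma measurable_total_noise [measurable]: "total_noise C t \<in> borel_measurable S"
  unfolding total_noise_def by measurable

lemma nn_integral_noise:
  assumes [measurable]: "h \<in> borel_measurable borel"
  shows "(\<integral>\<^sup>+ y. h (noise C t y n) \<partial>S) =
    (\<integral>\<^sup>+ y. \<integral>\<^sup>+ x. h (lower_eval C (fst x) (t - walk y n)) \<partial>Q \<partial>S)"
proof -
  \<comment> \<open>Split at \<open>n\<close>: the path becomes coordinate 0 of the fresh sequence
    \<open>z\<close>, whose own walk is still at 0.\<close>
  have "(\<integral>\<^sup>+ y. h (noise C t y n) \<partial>S) =
      (\<integral>\<^sup>+ y. \<integral>\<^sup>+ z. h (lower_eval C (fst (z 0)) (t - walk y n)) \<partial>S \<partial>S)"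
    using noise_comb_seq_add[of C t n _ _ 0]
    by (subst nn_integral_comb_seq[of _ n]) (simp_all add: noise_def walk_def[of _ 0])
  also have "\<dots> = (\<integral>\<^sup>+ y. \<integral>\<^sup>+ x. h (lower_eval C (fst x) (t - walk y n)) \<partial>Q \<partial>S)"
    by (intro nn_integral_cong nn_integral_component) measurable
  finally show ?thesis .
qed

text \<open>Given the first \<open>n\<close> coordinates, the evaluation time is deterministic and
  the law of the path is unchanged, so \<open>AE_eval\<close> carries over to the random
  time.\<close>

lemma AE_S_noise_eq_upper_eval:
  "AE y in S. \<forall>n. noise C t y n = upper_eval C (fst (y n)) (t - walk y n)"
proof -
  note [measurable] = measurable_upper_eval[OF countable_C]
  have "AE y in S. noise C t y n = upper_eval C (fst (y n)) (t - walk y n)" for n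
  proof -
    \<comment> \<open>Indicator of disagreement; its integral is shown to vanish.\<close>
    define E where "E w = (if lower_eval C (fst (fst w)) (snd w) = upper_eval C (fst (fst w)) (snd w)
      then 0 else 1 :: ennreal)"
      for w :: "((real \<Rightarrow> real) \<times> real) \<times> real"
    have [measurable]: "E \<in> borel_measurable (Q \<Otimes>\<^sub>M borel)"
      unfolding E_def by measurable
    have "(\<integral>\<^sup>+ y. E (y n, t - walk y n) \<partial>S) =
        (\<integral>\<^sup>+ y. \<integral>\<^sup>+ z. E (z 0, t - walk y n) \<partial>S \<partial>S)"
      by (subst nn_integral_comb_seq[of _ n])
        (simp_all add: walk_comb_seq_le comb_seq_add[of n _ _ 0, simplified])
    also have "\<dots> = (\<integral>\<^sup>+ y. \<integral>\<^sup>+ x. E (x, t - walk y n) \<partial>Q \<partial>S)"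
      by (intro nn_integral_cong nn_integral_component) measurable
    also have "\<dots> = (\<integral>\<^sup>+ y. 0 \<partial>S)"
    proof (intro nn_integral_cong)
      fix y
      have "AE x in Q. E (x, t - walk y n) = 0"
        using AE_eval[of "t - walk y n"] by eventually_elim (simp add: E_def)
      then show "(\<integral>\<^sup>+ x. E (x, t - walk y n) \<partial>Q) = 0"
        by (subst nn_integral_0_iff_AE) auto
    qed
    finally have "(\<integral>\<^sup>+ y. E (y n, t - walk y n) \<partial>S) = 0"
      by simp
    then have "AE y in S. E (y n, t - walk y n) = 0"
      by (subst (asm) nn_integral_0_iff_AE) auto
    then show ?thesis
      by eventually_elim (auto simp: E_def noise_def split: if_splits)
  qed
  then show ?thesis
    by (simp add: AE_all_countable)
qed

text \<open>Interchange sum and integral, then use superadditivity of the \<open>q\<close>-th power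
  pointwise.\<close>

lemma suminf_noise_moment_le:
  assumes "1 \<le> q" "q \<le> p"
  shows "(\<Sum>n. \<integral>\<^sup>+ y. ennreal_powr (noise C t y n) q \<partial>S) \<le>
    1 + (\<integral>\<^sup>+ y. ennreal_powr (total_noise C t y) p \<partial>S)"
proof -
  have "(\<Sum>n. \<integral>\<^sup>+ y. ennreal_powr (noise C t y n) q \<partial>S) =
      (\<integral>\<^sup>+ y. (\<Sum>n. ennreal_powr (noise C t y n) q) \<partial>S)"
    by (rule nn_integral_suminf[symmetric]) measurable
  also have "\<dots> \<le> (\<integral>\<^sup>+ y. 1 + ennreal_powr (total_noise C t y) p \<partial>S)"
    using assms unfolding total_noise_def
    by (intro nn_integral_mono order_trans[OF suminf_ennreal_powr_le] ennreal_powr_le_one_plus) auto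
  also have "\<dots> = 1 + (\<integral>\<^sup>+ y. ennreal_powr (total_noise C t y) p \<partial>S)"
    by (subst nn_integral_add) (auto simp: P.emeasure_space_1)
  finally show ?thesis .
qed

text \<open>Only the part of the path after time \<open>n\<close> enters the tail, and as the steps are
  nonnegative, delaying that part by the walk can only decrease its noise.\<close>

lemma nn_integral_noise_mult_tail_le:
  assumes "0 \<le> s"
  shows "(\<integral>\<^sup>+ y. noise C t y n * ennreal_powr (\<Sum>k. noise C t y (k + Suc n)) s \<partial>S) \<le>
    (\<integral>\<^sup>+ y. noise C t y n \<partial>S) * (\<integral>\<^sup>+ y. ennreal_powr (total_noise C t y) s \<partial>S)"
proof -
  have AE_walk: "AE y in S. 0 \<le> walk y (Suc n)"
  proof -
    have "AE y in S. \<forall>k. 0 \<le> snd (y k)"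
      using AE_PiM_component[of UNIV "\<lambda>_. Q" _ "\<lambda>x. 0 \<le> snd x"] AE_nonneg prob_space
      by (auto simp: AE_all_countable)
    then show ?thesis
      by eventually_elim (auto simp: walk_def simp del: sum.lessThan_Suc intro: sum_nonneg)
  qed
  \<comment> \<open>The cut is at \<open>Suc n\<close>, as the \<open>n\<close>-th noise term uses
    coordinate \<open>n\<close> as well; the tail then sees \<open>y\<close> only through the
    walk.\<close>
  have "(\<integral>\<^sup>+ y. noise C t y n * ennreal_powr (\<Sum>k. noise C t y (k + Suc n)) s \<partial>S) =
      (\<integral>\<^sup>+ y. \<integral>\<^sup>+ z. noise C t y n *
        ennreal_powr (\<Sum>k. noise C (t - walk y (Suc n)) z k) s \<partial>S \<partial>S)"
    by (subst nn_integral_comb_seq[of _ "Suc n"])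
      (simp_all add: noise_comb_seq_less noise_comb_seq_add del: add_Suc_right)
  \<comment> \<open>Replacing the delayed time by \<open>t\<close> removes \<open>y\<close> from the
    second factor, so the double integral becomes a product.\<close>
  also have "\<dots> \<le> (\<integral>\<^sup>+ y. \<integral>\<^sup>+ z. noise C t y n * ennreal_powr (total_noise C t z) s \<partial>S \<partial>S)"
    using AE_walk
    by (intro nn_integral_mono_AE)
      (auto elim!: eventually_mono simp: total_noise_def
        intro!: nn_integral_mono mult_left_mono ennreal_powr_mono suminf_le noise_mono assms)
  also have "\<dots> = (\<integral>\<^sup>+ y. noise C t y n \<partial>S) * (\<integral>\<^sup>+ y. ennreal_powr (total_noise C t y) s \<partial>S)"
    by (simp add: nn_integral_cmult nn_integral_multc)
  finally show ?thesis .
qed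

lemma nn_integral_total_noise: "(\<integral>\<^sup>+ y. total_noise C t y \<partial>S) = (\<Sum>n. \<integral>\<^sup>+ y. noise C t y n \<partial>S)"
  unfolding total_noise_def by (rule nn_integral_suminf) measurable

text \<open>Finite mean makes the total noise almost surely finite, so the pathwise series bound
  applies; each cross term is then bounded by a product of expectations.\<close>

lemma nn_integral_powr_total_noise_le:
  assumes "1 \<le> p" and fin: "(\<Sum>n. \<integral>\<^sup>+ y. noise C t y n \<partial>S) < \<infinity>"
  shows "(\<integral>\<^sup>+ y. ennreal_powr (total_noise C t y) p \<partial>S) \<le> ennreal (p * 2 powr (p - 1)) *
    ((\<Sum>n. \<integral>\<^sup>+ y. ennreal_powr (noise C t y n) p \<partial>S) + (\<Sum>n. \<integral>\<^sup>+ y. noise C t y n \<partial>S) *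
      (\<integral>\<^sup>+ y. ennreal_powr (total_noise C t y) (p - 1) \<partial>S))"
proof -
  let ?R = "\<lambda>y n. ennreal_powr (\<Sum>k. noise C t y (k + Suc n)) (p - 1)"
  have "AE y in S. total_noise C t y \<noteq> \<infinity>"
    using fin nn_integral_total_noise by (intro nn_integral_PInf_AE) auto
  then have "(\<integral>\<^sup>+ y. ennreal_powr (total_noise C t y) p \<partial>S) \<le>
      (\<integral>\<^sup>+ y. ennreal (p * 2 powr (p - 1)) *
        (\<Sum>n. ennreal_powr (noise C t y n) p + noise C t y n * ?R y n) \<partial>S)"
    unfolding total_noise_def
    by (intro nn_integral_mono_AE, eventually_elim)
      (rule ennreal_powr_suminf_le[OF \<open>1 \<le> p\<close>], simp add: top.not_eq_extremum)
  also have "\<dots> = ennreal (p * 2 powr (p - 1)) *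
      ((\<Sum>n. \<integral>\<^sup>+ y. ennreal_powr (noise C t y n) p \<partial>S) +
       (\<Sum>n. \<integral>\<^sup>+ y. noise C t y n * ?R y n \<partial>S))"
    by (simp add: nn_integral_cmult nn_integral_suminf nn_integral_add suminf_add)
  also have "\<dots> \<le> ennreal (p * 2 powr (p - 1)) *
      ((\<Sum>n. \<integral>\<^sup>+ y. ennreal_powr (noise C t y n) p \<partial>S) +
       (\<Sum>n. (\<integral>\<^sup>+ y. noise C t y n \<partial>S) *
         (\<integral>\<^sup>+ y. ennreal_powr (total_noise C t y) (p - 1) \<partial>S)))"
    using \<open>1 \<le> p\<close>
    by (intro mult_left_mono add_left_mono suminf_le nn_integral_noise_mult_tail_le) auto
  finally show ?thesis
    by simp
qed

text \<open>Base of the induction on the exponent: such powers are dominated by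
  \<open>1 + total_noise C t y\<close>.\<close>

lemma total_noise_low_moment_finite:
  assumes "0 \<le> p" "p \<le> 1" and fin: "(\<Sum>n. \<integral>\<^sup>+ y. noise C t y n \<partial>S) < \<infinity>"
  shows "(\<integral>\<^sup>+ y. ennreal_powr (total_noise C t y) p \<partial>S) < \<infinity>"
proof -
  have "(\<integral>\<^sup>+ y. ennreal_powr (total_noise C t y) p \<partial>S) \<le> (\<integral>\<^sup>+ y. 1 + total_noise C t y \<partial>S)"
    using ennreal_powr_le_one_plus[OF assms(1,2)] by (intro nn_integral_mono) auto
  also have "\<dots> = 1 + (\<Sum>n. \<integral>\<^sup>+ y. noise C t y n \<partial>S)"
    by (subst nn_integral_add) (auto simp: P.emeasure_space_1 nn_integral_total_noise)
  also have "\<dots> < \<infinity>"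
    using fin by (simp add: ennreal_add_less_top)
  finally show ?thesis .
qed

lemma total_noise_moment_finite:
  assumes "1 \<le> p"
    and fin: "\<And>q. 1 \<le> q \<Longrightarrow> q \<le> p \<Longrightarrow>
      (\<Sum>n. \<integral>\<^sup>+ y. ennreal_powr (noise C t y n) q \<partial>S) < \<infinity>"
  shows "(\<integral>\<^sup>+ y. ennreal_powr (total_noise C t y) p \<partial>S) < \<infinity>"
proof -
  have mean: "(\<Sum>n. \<integral>\<^sup>+ y. noise C t y n \<partial>S) < \<infinity>"
    using fin[of 1] \<open>1 \<le> p\<close> by simp
  \<comment> \<open>The recursion lowers the exponent by 1, hence the induction on an integer bound
    \<open>n\<close> for a real exponent \<open>r\<close>.\<close>
  have "(\<integral>\<^sup>+ y. ennreal_powr (total_noise C t y) r \<partial>S) < \<infinity>"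
    if "0 \<le> r" "r \<le> real n" "r \<le> p" for r n
    using that
  proof (induction n arbitrary: r)
    case 0
    then show ?case
      using mean by (intro total_noise_low_moment_finite) auto
  next
    case (Suc n)
    show ?case
    proof (cases "1 \<le> r")
      case True
      have "(\<integral>\<^sup>+ y. ennreal_powr (total_noise C t y) (r - 1) \<partial>S) < \<infinity>"
        using True Suc.prems by (intro Suc.IH) auto
      then have "ennreal (r * 2 powr (r - 1)) *
          ((\<Sum>n. \<integral>\<^sup>+ y. ennreal_powr (noise C t y n) r \<partial>S) + (\<Sum>n. \<integral>\<^sup>+ y. noise C t y n \<partial>S) *
            (\<integral>\<^sup>+ y. ennreal_powr (total_noise C t y) (r - 1) \<partial>S)) < \<infinity>"
        using mean fin[OF True Suc.prems(3)]
        by (simp add: ennreal_mult_less_top ennreal_add_less_top)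
      then show ?thesis
        using nn_integral_powr_total_noise_le[OF True mean] by (rule le_less_trans[rotated])
    next
      case False
      then show ?thesis
        using mean Suc.prems by (intro total_noise_low_moment_finite) auto
    qed
  qed
  from this[of p "nat \<lceil>p\<rceil>"] show ?thesis
    using \<open>1 \<le> p\<close> by simp
qed

end

section \<open>Integrals against the renewal measure\<close>

text \<open>Viewing it as an image of counting measure times \<open>M\<close> makes change of
  variables and Tonelli available.\<close>

lemma renewal_measure_eq_distr:
  assumes "prob_space M" and [measurable]: "\<And>n. random_walk \<xi>s n \<in> borel_measurable M"
  shows "renewal_measure M \<xi>s =
    distr (count_space UNIV \<Otimes>\<^sub>M M) borel (\<lambda>(n, \<omega>). random_walk \<xi>s n \<omega>)"
proof (rule measure_eqI)
  interpret prob_space M by fact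
  fix B assume "B \<in> sets (renewal_measure M \<xi>s)"
  then have [measurable]: "B \<in> sets borel"
    by simp
  have [measurable]: "(\<lambda>(n, \<omega>). random_walk \<xi>s n \<omega>) \<in> borel_measurable (count_space UNIV \<Otimes>\<^sub>M M)"
    by (rule measurable_pair_measure_countable1) auto
  let ?A = "(\<lambda>(n, \<omega>). random_walk \<xi>s n \<omega>) -` B \<inter> space (count_space UNIV \<Otimes>\<^sub>M M)"
  have "emeasure (distr (count_space UNIV \<Otimes>\<^sub>M M) borel (\<lambda>(n, \<omega>). random_walk \<xi>s n \<omega>)) B =
      emeasure (count_space UNIV \<Otimes>\<^sub>M M) ?A"
    by (rule emeasure_distr) auto
  also have "\<dots> = (\<integral>\<^sup>+ n. emeasure M (Pair n -` ?A) \<partial>count_space UNIV)"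
    by (rule emeasure_pair_measure_alt) measurable
  also have "\<dots> = (\<Sum>n. emeasure (distr M borel (random_walk \<xi>s n)) B)"
    by (auto simp: nn_integral_count_space_nat emeasure_distr space_pair_measure
        intro!: suminf_cong arg_cong[where f = "emeasure M"])
  finally show "emeasure (renewal_measure M \<xi>s) B =
      emeasure (distr (count_space UNIV \<Otimes>\<^sub>M M) borel (\<lambda>(n, \<omega>). random_walk \<xi>s n \<omega>)) B"
    by (simp add: emeasure_renewal_measure)
qed simp

lemma nn_integral_renewal_measure:
  assumes M: "prob_space M" and walk [measurable]: "\<And>n. random_walk \<xi>s n \<in> borel_measurable M"
    and [measurable]: "f \<in> borel_measurable borel"
  shows "(\<integral>\<^sup>+ y. f y \<partial>renewal_measure M \<xi>s) = (\<Sum>n. \<integral>\<^sup>+ \<omega>. f (random_walk \<xi>s n \<omega>) \<partial>M)"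
proof -
  interpret prob_space M by fact
  have [measurable]: "(\<lambda>(n, \<omega>). random_walk \<xi>s n \<omega>) \<in> borel_measurable (count_space UNIV \<Otimes>\<^sub>M M)"
    by (rule measurable_pair_measure_countable1) auto
  have "(\<integral>\<^sup>+ y. f y \<partial>renewal_measure M \<xi>s) =
      (\<integral>\<^sup>+ x. f (case x of (n, \<omega>) \<Rightarrow> random_walk \<xi>s n \<omega>) \<partial>(count_space UNIV \<Otimes>\<^sub>M M))"
    unfolding renewal_measure_eq_distr[OF M walk] by (rule nn_integral_distr) auto
  also have "\<dots> = (\<integral>\<^sup>+ n. \<integral>\<^sup>+ \<omega>. f (random_walk \<xi>s n \<omega>) \<partial>M \<partial>count_space UNIV)"
    by (subst nn_integral_fst[symmetric]) auto
  finally show ?thesis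
    by (simp add: nn_integral_count_space_nat)
qed

section \<open>Transfer to the sequence space and conclusion\<close>

theorem theorem3p7:
  fixes N :: "'b measure" and X :: "'b \<Rightarrow> real \<Rightarrow> real" and \<xi> :: "'b \<Rightarrow> real"
    and M :: "'a measure" and Xs :: "nat \<Rightarrow> 'a \<Rightarrow> real \<Rightarrow> real" and \<xi>s :: "nat \<Rightarrow> 'a \<Rightarrow> real"
    and p t :: real
  assumes "prob_space N" and "prob_space M"
    and "\<xi> \<in> borel_measurable N" and "measure N {\<omega> \<in> space N. \<xi> \<omega> = 0} < 1"
    and "X \<in> measurable N monotone_paths"
    and "AE \<omega> in N. (X \<omega> \<longlongrightarrow> 0) at_bot"
    and "independent_copies N M (monotone_paths \<Otimes>\<^sub>M borel)
           (\<lambda>\<omega>. (X \<omega>, \<xi> \<omega>)) (\<lambda>n \<omega>. (Xs n \<omega>, \<xi>s n \<omega>))"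
    and "AE \<omega> in N. 0 \<le> \<xi> \<omega>"
    and "1 \<le> p"
  shows "(\<integral>\<^sup>+ \<omega>. ennreal_powr (shot_noise Xs \<xi>s t \<omega>) p \<partial>M) < \<infinity> \<longleftrightarrow>
    (\<forall>q\<in>{1..p}. power_moment_integral N X (renewal_measure M \<xi>s) q t < \<infinity>)"
proof -
  interpret PN: prob_space N by fact
  interpret PM: prob_space M by fact
  note [measurable] = assms(3,5)
  let ?L = "monotone_paths \<Otimes>\<^sub>M borel :: ((real \<Rightarrow> real) \<times> real) measure"
  let ?Y = "\<lambda>n \<omega>. (Xs n \<omega>, \<xi>s n \<omega>)"
  define Q where "Q = distr N ?L (\<lambda>\<omega>. (X \<omega>, \<xi> \<omega>))"
  define T where "T \<omega> n = ?Y (Suc n) \<omega>" for \<omega> n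
  \<comment> \<open>One \<open>C\<close> serves all copies, since the almost sure identity depends
    only on the law of the path.\<close>
  obtain C where C: "countable C"
    and eval_N: "\<And>x. AE \<omega> in N. lower_eval C (X \<omega>) x = upper_eval C (X \<omega>) x"
    using PN.AE_lower_eval_eq_upper_eval[OF assms(5)] by blast
  note [measurable] = measurable_lower_eval[OF C] measurable_upper_eval[OF C]
  have Q: "prob_space Q"
    unfolding Q_def by (rule PN.prob_space_distr) measurable
  interpret renewal_law Q C
  proof (intro renewal_law.intro sequence_space.intro product_prob_spaceI Q renewal_law_axioms.intro)
    show sets_Q: "sets Q = sets ?L"
      by (simp add: Q_def)
    show "countable C" by (rule C)
    show "AE y in Q. lower_eval C (fst y) x = upper_eval C (fst y) x" for x
      unfolding Q_def using eval_N[of x] by (subst AE_distr_iff) auto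
    show "AE y in Q. 0 \<le> snd y"
      unfolding Q_def using assms(8) by (subst AE_distr_iff) auto
  qed
  have indep: "PM.indep_vars (\<lambda>_. ?L) ?Y {1..}" and law: "\<forall>n\<ge>1. distr M ?L (?Y n) = Q"
    using assms(7) unfolding independent_copies_def Q_def by blast+
  have Y [measurable]: "?Y n \<in> measurable M ?L" if "n \<in> {1..}" for n
    using indep that by (auto simp: PM.indep_vars_def)
  have "distr M (\<Pi>\<^sub>M n\<in>{1..}. ?L) (\<lambda>\<omega>. \<lambda>n\<in>{1..}. ?Y n \<omega>) = (\<Pi>\<^sub>M n\<in>{1..}. distr M ?L (?Y n))"
    using indep by (subst (asm) PM.indep_vars_iff_distr_eq_PiM') (auto intro: Y)
  also have "\<dots> = (\<Pi>\<^sub>M n\<in>{1..}. Q)"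
    using law by (intro PiM_cong) auto
  finally have joint: "distr M (\<Pi>\<^sub>M n\<in>{1..}. ?L) (\<lambda>\<omega>. \<lambda>n\<in>{1..}. ?Y n \<omega>) = (\<Pi>\<^sub>M n\<in>{1..}. Q)" .
  have T [measurable]: "T \<in> measurable M S"
    unfolding T_def by (rule measurable_PiM_single')
      (use measurable_space[OF Y] in \<open>auto simp: Q_def\<close>)
  \<comment> \<open>Reindexing along \<open>Suc\<close> turns the index set \<open>{1..}\<close>
    into all naturals.\<close>
  have "distr M S T = distr (distr M (\<Pi>\<^sub>M n\<in>{1..}. ?L) (\<lambda>\<omega>. \<lambda>n\<in>{1..}. ?Y n \<omega>)) S
      (\<lambda>y. \<lambda>n\<in>UNIV. y (Suc n))"
    by (subst distr_distr) (auto simp: T_def o_def fun_eq_iff intro!: distr_cong)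
  also have "\<dots> = S"
    unfolding joint using Q by (intro distr_PiM_reindex) auto
  finally have distr_T: "distr M S T = S" .
  have walk_T: "random_walk \<xi>s n \<omega> = walk (T \<omega>) n" for n \<omega>
    by (simp add: random_walk_def walk_def T_def sum.atLeast1_atMost_eq)
  have [measurable]: "random_walk \<xi>s n \<in> borel_measurable M" for n
    unfolding walk_T[abs_def] by measurable
  have transfer: "(\<integral>\<^sup>+ \<omega>. f (T \<omega>) \<partial>M) = (\<integral>\<^sup>+ y. f y \<partial>S)" if "f \<in> borel_measurable S" for f
    using nn_integral_distr[OF T, of f] that by (simp add: distr_T)

  have "AE \<omega> in M. \<forall>n. noise C t (T \<omega>) n = upper_eval C (fst (T \<omega> n)) (t - walk (T \<omega>) n)"
    by (rule AE_distrD[OF T, unfolded distr_T, OF AE_S_noise_eq_upper_eval])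
  then have "AE \<omega> in M. shot_noise Xs \<xi>s t \<omega> = total_noise C t (T \<omega>)"
    using AE_space[of M]
  proof eventually_elim
    case (elim \<omega>)
    \<comment> \<open>The path value is squeezed between two evaluations that coincide at this
      random time.\<close>
    have "ennreal (Xs (Suc n) \<omega> (t - random_walk \<xi>s n \<omega>)) = noise C t (T \<omega>) n" for n
    proof -
      have "mono (Xs (Suc n) \<omega>)"
        using measurable_space[OF Y[of "Suc n"] elim(2)]
        by (simp add: space_pair_measure space_monotone_paths)
      then show ?thesis
        using elim(1) lower_eval_le[of "Xs (Suc n) \<omega>" C "t - random_walk \<xi>s n \<omega>"]
          le_upper_eval[of "Xs (Suc n) \<omega>" "t - random_walk \<xi>s n \<omega>" C]
        by (auto simp: noise_def walk_T T_def intro!: antisym)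
    qed
    then show ?case
      by (simp add: shot_noise_def total_noise_def)
  qed
  then have "(\<integral>\<^sup>+ \<omega>. ennreal_powr (shot_noise Xs \<xi>s t \<omega>) p \<partial>M) =
      (\<integral>\<^sup>+ \<omega>. ennreal_powr (total_noise C t (T \<omega>)) p \<partial>M)"
    by (intro nn_integral_cong_AE) auto
  also have "\<dots> = (\<integral>\<^sup>+ y. ennreal_powr (total_noise C t y) p \<partial>S)"
    by (rule transfer) measurable
  finally have left: "(\<integral>\<^sup>+ \<omega>. ennreal_powr (shot_noise Xs \<xi>s t \<omega>) p \<partial>M) =
    (\<integral>\<^sup>+ y. ennreal_powr (total_noise C t y) p \<partial>S)" .

  have right: "power_moment_integral N X (renewal_measure M \<xi>s) q t =
    (\<Sum>n. \<integral>\<^sup>+ y. ennreal_powr (noise C t y n) q \<partial>S)" for q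
  proof -
    let ?J = "\<lambda>u. \<integral>\<^sup>+ x. ennreal_powr (lower_eval C (fst x) (t - u)) q \<partial>Q"
    \<comment> \<open>Here the time \<open>t - u\<close> is fixed, so a null set depending on
      \<open>u\<close> is harmless; the new form is measurable in \<open>u\<close>.\<close>
    have J: "(\<integral>\<^sup>+ \<omega>. ennreal (X \<omega> (t - u) powr q) \<partial>N) = ?J u" for u
    proof -
      have "AE \<omega> in N. ennreal (X \<omega> (t - u) powr q) =
          ennreal_powr (lower_eval C (X \<omega>) (t - u)) q"
        using eval_N[of "t - u"] AE_space[of N]
      proof eventually_elim
        case (elim \<omega>)
        then have X: "mono (X \<omega>)" "0 \<le> X \<omega> (t - u)"
          using measurable_space[OF assms(5)] by (auto simp: space_monotone_paths)
        then have "lower_eval C (X \<omega>) (t - u) = ennreal (X \<omega> (t - u))"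
          using elim(1) lower_eval_le[of "X \<omega>" C "t - u"] le_upper_eval[of "X \<omega>" "t - u" C]
          by (intro antisym) auto
        then show ?case
          using X by (simp add: ennreal_powr_ennreal)
      qed
      then have "(\<integral>\<^sup>+ \<omega>. ennreal (X \<omega> (t - u) powr q) \<partial>N) =
          (\<integral>\<^sup>+ \<omega>. ennreal_powr (lower_eval C (X \<omega>) (t - u)) q \<partial>N)"
        by (rule nn_integral_cong_AE)
      also have "\<dots> = ?J u"
        unfolding Q_def by (subst nn_integral_distr) auto
      finally show ?thesis .
    qed
    have [measurable]: "?J \<in> borel_measurable borel"
      by measurable
    have "power_moment_integral N X (renewal_measure M \<xi>s) q t =
        (\<Sum>n. \<integral>\<^sup>+ \<omega>. ?J (random_walk \<xi>s n \<omega>) \<partial>M)"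
      unfolding power_moment_integral_def J
      by (rule nn_integral_renewal_measure) (measurable, rule assms(2), measurable)
    also have "\<dots> = (\<Sum>n. \<integral>\<^sup>+ y. ?J (walk y n) \<partial>S)"
      unfolding walk_T by (intro suminf_cong transfer) measurable
    \<comment> \<open>Independence of the path and the preceding walk merges the two integrals into
      one.\<close>
    also have "\<dots> = (\<Sum>n. \<integral>\<^sup>+ y. ennreal_powr (noise C t y n) q \<partial>S)"
      by (intro suminf_cong nn_integral_noise[symmetric]) measurable
    finally show ?thesis .
  qed

  show ?thesis
    unfolding left right
  proof safe
    fix q assume q: "q \<in> {1..p}" and "(\<integral>\<^sup>+ y. ennreal_powr (total_noise C t y) p \<partial>S) < \<infinity>"
    then have "1 + (\<integral>\<^sup>+ y. ennreal_powr (total_noise C t y) p \<partial>S) < \<infinity>"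
      by (simp add: ennreal_add_less_top)
    then show "(\<Sum>n. \<integral>\<^sup>+ y. ennreal_powr (noise C t y n) q \<partial>S) < \<infinity>"
      using q by (intro le_less_trans[OF suminf_noise_moment_le[of q p]]) auto
  next
    assume "\<forall>q\<in>{1..p}. (\<Sum>n. \<integral>\<^sup>+ y. ennreal_powr (noise C t y n) q \<partial>S) < \<infinity>"
    then show "(\<integral>\<^sup>+ y. ennreal_powr (total_noise C t y) p \<partial>S) < \<infinity>"
      using \<open>1 \<le> p\<close> by (intro total_noise_moment_finite) auto
  qed
qed

end
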